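(* Let $D,n\ge 1$ be integers and let $\Lambda=(\Lambda_1,\dots,\Lambda_D)$ be a sequence of subsets of $\mathbb Z_n$. Define $$W_{\Lambda,\mathcal P}:=\{\mathbf p\in\mathbb Z_n^D: H_\Lambda\mathbf p\subseteq\mathcal P\},$$ where $H_\Lambda\mathbf p$ is the orbit of $\mathbf p$ under $H_\Lambda$ and $\mathcal P=\mathcal P_n^D$ is the principal lattice. Then $$\forall A\in G_n^D,\qquad A\,W_{\Lambda,\mathcal P}=\bigcap_{B\in AH_\Lambda}B\mathcal P,$$ where the left coset $AH_\Lambda$ is the set of all $D$-permutations $B\in G_n^D$ whose actions agree with that of $A$ on each $\Lambda_i$, i.e. $b_i(j)=a_i(j)$ for all $i\in\{1,\dots,D\}$ and all $j\in\Lambda_i$.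
   Context: Notation: $\mathbb Z_n=\{0,1,\dots,n\}$ and $\mathbb Z_n^D=(\mathbb Z_n)^D$. Principal lattice: $\mathcal P_n^D=\{(j_1,\dots,j_D)\in\mathbb Z^D: j_k\ge 0,\ \sum_k j_k\le n\}$. $D$-permutation of degree $n$: a map $A=(a_1,\dots,a_D)^T:\mathbb Z_n^D\to\mathbb Z_n^D$, $A\mathbf p=(a_1(p_1),\dots,a_D(p_D))^T$, where each $a_i:\mathbb Z_n\to\mathbb Z_n$ is a permutation. $G_n^D$ is the set of all $D$-permutations of degree $n$; it is a group under $A\cdot B=(a_1\circ b_1,\dots,a_D\circ b_D)^T$. For $T\subseteq\mathbb Z_n^D$, $AT=\{A\mathbf p:\mathbf p\in T\}$. $H_\Lambda:=\{A\in G_n^D: a_i(j)=j\ \text{for all } i\in\{1,\dots,D\},\ j\in\Lambda_i\}$, a subgroup of $G_n^D$. The orbit of $\mathbf p$ under $H_\Lambda$ is $H_\Lambda\mathbf p=\{h\mathbf p:h\in H_\Lambda\}$; explicitly $H_\Lambda\mathbf p=\prod_{i=1}^D W^\times(p_i,\Lambda_i)$ with $W^\times(p_i,\Lambda_i)=\{p_i\}$ if $p_i\in\Lambda_i$ and $W^\times(p_i,\Lambda_i)=\mathbb Z_n\setminus\Lambda_i$ otherwise. The left coset is $AH_\Lambda=\{A\cdot h:h\in H_\Lambda\}$. *)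

theory Defs
  imports "HOL-Algebra.Group_Action" "HOL-Algebra.Product_Groups"
begin

text \<open>
  Points with \<open>D\<close> coordinates are functions on the index set \<open>{1..D}\<close>, equal to
  \<open>undefined\<close> outside it. Coordinates have type \<open>nat\<close>, which encodes \<open>j\<^sub>k \<ge> 0\<close>.
\<close>

definition grid :: "nat \<Rightarrow> nat \<Rightarrow> (nat \<Rightarrow> nat) set" where
  "grid n D = {1..D} \<rightarrow>\<^sub>E {0..n}"

definition principal_lattice :: "nat \<Rightarrow> nat \<Rightarrow> (nat \<Rightarrow> nat) set" where
  "principal_lattice n D = {p \<in> {1..D} \<rightarrow>\<^sub>E UNIV. (\<Sum>k = 1..D. p k) \<le> n}"

text \<open>
  A \<open>D\<close>-permutation is represented by its tuple of components \<open>(a\<^sub>1, \<dots>, a\<^sub>D)\<close>;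
  \<open>dperm_map\<close> is the map on the grid which such a tuple stands for. In \<^const>\<open>BijGroup\<close>
  the multiplication is composition.
\<close>

definition dperm_group :: "nat \<Rightarrow> nat \<Rightarrow> (nat \<Rightarrow> nat \<Rightarrow> nat) monoid" where
  "dperm_group n D = product_group {1..D} (\<lambda>i. BijGroup {0..n})"

definition dperm_map ::
    "nat \<Rightarrow> nat \<Rightarrow> (nat \<Rightarrow> nat \<Rightarrow> nat) \<Rightarrow> (nat \<Rightarrow> nat) \<Rightarrow> (nat \<Rightarrow> nat)" where
  "dperm_map n D A = (\<lambda>p \<in> grid n D. \<lambda>i \<in> {1..D}. A i (p i))"

definition fixing_subgroup ::
    "nat \<Rightarrow> nat \<Rightarrow> (nat \<Rightarrow> nat set) \<Rightarrow> (nat \<Rightarrow> nat \<Rightarrow> nat) set" where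
  "fixing_subgroup n D \<Lambda> =
     {A \<in> carrier (dperm_group n D). \<forall>i\<in>{1..D}. \<forall>j\<in>\<Lambda> i. A i j = j}"

definition fixing_orbit ::
    "nat \<Rightarrow> nat \<Rightarrow> (nat \<Rightarrow> nat set) \<Rightarrow> (nat \<Rightarrow> nat) \<Rightarrow> (nat \<Rightarrow> nat) set" where
  "fixing_orbit n D \<Lambda> p =
     orbit (dperm_group n D\<lparr>carrier := fixing_subgroup n D \<Lambda>\<rparr>) (dperm_map n D) p"

definition W_set :: "nat \<Rightarrow> nat \<Rightarrow> (nat \<Rightarrow> nat set) \<Rightarrow> (nat \<Rightarrow> nat) set" where
  "W_set n D \<Lambda> = {p \<in> grid n D. fixing_orbit n D \<Lambda> p \<subseteq> principal_lattice n D}"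

end

theory Submission
  imports Defs
begin

text \<open>
  The identity is a fact about any group \<open>G\<close> acting on a set \<open>E\<close>, any subgroup \<open>H\<close> and any
  \<open>P \<subseteq> E\<close>. Write \<open>W\<close> for the set of points whose whole \<open>H\<close>-orbit lies in \<open>P\<close>. The orbit of \<open>x\<close>
  lies in \<open>P\<close> exactly if \<open>h\<^sup>-\<^sup>1x \<in> P\<close> for all \<open>h \<in> H\<close>, since \<open>H\<close> is closed under inverses; hence
  \<open>W\<close> is the intersection of the translates \<open>hP\<close>. Each \<open>a \<in> G\<close> acts as a bijection, and so
  carries this intersection to the intersection of the sets \<open>ahP\<close>, where \<open>ah\<close> runs through
  the coset \<open>aH\<close>. This is \<open>group_action.image_orbit_core\<close>.

  It applies to \<open>D\<close>-permutations because they act on the grid (\<open>dperm_group_action\<close>), the tuples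
  fixing each \<open>\<Lambda> i\<close> pointwise form a subgroup (\<open>subgroup_fixing\<close>), and the principal lattice lies
  in the grid: nonnegative coordinates with sum at most \<open>n\<close> are each at most \<open>n\<close>.
  Finally, \<open>B \<in> A H\<close> means that \<open>A\<^sup>-\<^sup>1 B\<close> fixes each \<open>\<Lambda> i\<close> pointwise, and by injectivity
  of the components of \<open>A\<close> this says that \<open>A\<close> and \<open>B\<close> agree there (\<open>l_coset_fixing\<close>).
\<close>

section \<open>Translates of the points with orbit in a given set\<close>

text \<open>
  Both inclusions use the same equivalence: for \<open>y = a x\<close>, the point \<open>h\<^sup>-\<^sup>1 x\<close> of the orbit is
  the only candidate for a preimage of \<open>y\<close> under \<open>a h\<close>. So \<open>y\<close> lies in the translate of \<open>P\<close> by
  \<open>a h\<close> exactly if this orbit point lies in \<open>P\<close>.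
\<close>

lemma (in group_action) image_orbit_core:
  assumes H: "subgroup H G" and a: "a \<in> carrier G" and P: "P \<subseteq> E"
  shows "\<phi> a ` {x \<in> E. orbit (G\<lparr>carrier := H\<rparr>) \<phi> x \<subseteq> P} = (\<Inter>b \<in> a <# H. \<phi> b ` P)"
    (is "_ ` ?W = ?I")
proof -
  interpret G: group G
    using group_hom by (rule group_hom.axioms(1))
  note HG = subgroup.mem_carrier [OF H]
  note comp = composition_rule [OF _ a HG]
  have orbit_H: "orbit (G\<lparr>carrier := H\<rparr>) \<phi> x = (\<lambda>h. \<phi> h x) ` H" for x
    by (auto simp: orbit_def)
  show ?thesis
  proof
    show "\<phi> a ` ?W \<subseteq> ?I"
    proof clarify
      fix x b
      assume x: "x \<in> E" and orb: "orbit (G\<lparr>carrier := H\<rparr>) \<phi> x \<subseteq> P" and "b \<in> a <# H"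
      then obtain h where h: "h \<in> H" and b: "b = a \<otimes> h"
        by (auto simp: l_coset_def)
      define z where "z = \<phi> (inv h) x"
      have z: "z \<in> P"
        using orb subgroup.m_inv_closed [OF H h] by (auto simp: orbit_H z_def)
      have "\<phi> h z = x"
        using orbit_sym_aux [of "inv h" x z] HG [OF h] x by (simp add: z_def)
      then have "\<phi> b z = \<phi> a x"
        using comp h z P by (auto simp: b)
      then show "\<phi> a x \<in> \<phi> b ` P"
        using z by force
    qed
  next
    show "?I \<subseteq> \<phi> a ` ?W"
    proof
      fix y
      assume y: "y \<in> ?I"
      have yI: "\<exists>z \<in> P. y = \<phi> a (\<phi> h z)" if "h \<in> H" for h
      proof -
        have "y \<in> \<phi> (a \<otimes> h) ` P"
          using y that by (auto simp: l_coset_def)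
        then show ?thesis
          using comp that P by auto
      qed
      \<comment> \<open>The element \<open>\<one>\<close> of \<open>H\<close> shows that \<open>y\<close> lies in \<open>E\<close>, so that it has a preimage under \<open>a\<close>.\<close>
      have "y \<in> E"
        using yI [OF subgroup.one_closed [OF H]] P a element_image by blast
      then obtain x where x: "x \<in> E" and xy: "\<phi> a x = y"
        using bij_prop1 [OF a] by blast
      have "\<phi> h x \<in> P" if h: "h \<in> H" for h
      proof -
        obtain z where z: "z \<in> P" "y = \<phi> a (\<phi> (inv h) z)"
          using yI subgroup.m_inv_closed [OF H h] by blast
        have inv: "inv h \<in> carrier G"
          using HG [OF h] by simp
        have "\<phi> (inv h) z = x"
          using inj_prop [OF a] x xy z P element_image [OF inv]
          by (metis inj_onD subsetD)
        then have "\<phi> h x = z"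
          using orbit_sym_aux [OF inv, of z x] z P HG [OF h] by auto
        then show ?thesis
          using z by simp
      qed
      then have "x \<in> ?W"
        using x by (auto simp: orbit_H)
      then show "y \<in> \<phi> a ` ?W"
        using xy by blast
    qed
  qed
qed

section \<open>The action of \<open>D\<close>-permutations on the grid\<close>

lemma principal_lattice_subset_grid: "principal_lattice n D \<subseteq> grid n D"
proof
  fix p
  assume p: "p \<in> principal_lattice n D"
  have "p i \<le> n" if "i \<in> {1..D}" for i
    using p member_le_sum [OF that, of p] by (auto simp: principal_lattice_def)
  then show "p \<in> grid n D"
    using p by (auto simp: principal_lattice_def grid_def PiE_iff)
qed

lemma group_dperm: "group (dperm_group n D)"
  by (simp add: dperm_group_def group_BijGroup)

lemma carrier_dperm: "carrier (dperm_group n D) = {1..D} \<rightarrow>\<^sub>E Bij {0..n}"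
  by (simp add: dperm_group_def BijGroup_def)

lemma dperm_component_bij:
  assumes "A \<in> carrier (dperm_group n D)" "i \<in> {1..D}"
  shows "bij_betw (A i) {0..n} {0..n}"
  using PiE_mem [OF assms(1) [unfolded carrier_dperm] assms(2)] by (simp add: Bij_def)

lemma dperm_component_le:
  assumes "A \<in> carrier (dperm_group n D)" "i \<in> {1..D}" "j \<le> n"
  shows "A i j \<le> n"
  using bij_betwE [OF dperm_component_bij [OF assms(1,2)]] assms(3) by auto

lemma dperm_component_eq_iff:
  assumes "A \<in> carrier (dperm_group n D)" "i \<in> {1..D}" "j \<le> n" "k \<le> n"
  shows "A i j = A i k \<longleftrightarrow> j = k"
  using bij_betw_imp_inj_on [OF dperm_component_bij [OF assms(1,2)]] assms(3,4)
  by (auto dest: inj_onD)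

lemma dperm_mult_apply:
  assumes "A \<in> carrier (dperm_group n D)" "B \<in> carrier (dperm_group n D)"
    and "i \<in> {1..D}" "j \<le> n"
  shows "(A \<otimes>\<^bsub>dperm_group n D\<^esub> B) i j = A i (B i j)"
  using assms PiE_mem [OF assms(1) [unfolded carrier_dperm] assms(3)]
    PiE_mem [OF assms(2) [unfolded carrier_dperm] assms(3)]
  by (simp add: dperm_group_def BijGroup_def compose_def)

lemma dperm_one_apply:
  assumes "i \<in> {1..D}" "j \<le> n"
  shows "\<one>\<^bsub>dperm_group n D\<^esub> i j = j"
  using assms by (simp add: dperm_group_def BijGroup_def)

lemma dperm_map_in_grid:
  assumes "A \<in> carrier (dperm_group n D)" "p \<in> grid n D"
  shows "dperm_map n D A p \<in> grid n D"
  using assms dperm_component_le [OF assms(1)] by (auto simp: dperm_map_def grid_def PiE_iff)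

text \<open>
  Surjectivity comes for free: the grid is finite, so an injective self-map of it is onto.
\<close>

lemma dperm_map_Bij:
  assumes A: "A \<in> carrier (dperm_group n D)"
  shows "dperm_map n D A \<in> Bij (grid n D)"
proof -
  have "inj_on (dperm_map n D A) (grid n D)"
  proof (rule inj_onI)
    fix p q
    assume pq: "p \<in> grid n D" "q \<in> grid n D" and eq: "dperm_map n D A p = dperm_map n D A q"
    show "p = q"
    proof (rule PiE_ext)
      show "p \<in> {1..D} \<rightarrow>\<^sub>E {0..n}" "q \<in> {1..D} \<rightarrow>\<^sub>E {0..n}"
        using pq by (simp_all add: grid_def)
      fix i
      assume i: "i \<in> {1..D}"
      then have "A i (p i) = A i (q i)"
        using fun_cong [OF eq, of i] pq by (simp add: dperm_map_def)
      then show "p i = q i"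
        using dperm_component_eq_iff [OF A i] pq i by (auto simp: grid_def PiE_iff)
    qed
  qed
  moreover have "finite (grid n D)"
    by (simp add: grid_def finite_PiE)
  moreover have "dperm_map n D A ` grid n D \<subseteq> grid n D"
    using dperm_map_in_grid [OF A] by blast
  ultimately have "bij_betw (dperm_map n D A) (grid n D) (grid n D)"
    by (simp add: bij_betw_def endo_inj_surj)
  then show ?thesis
    by (simp add: Bij_def dperm_map_def)
qed

lemma dperm_map_mult:
  assumes A: "A \<in> carrier (dperm_group n D)" and B: "B \<in> carrier (dperm_group n D)"
  shows "dperm_map n D (A \<otimes>\<^bsub>dperm_group n D\<^esub> B)
    = compose (grid n D) (dperm_map n D A) (dperm_map n D B)"
proof
  fix p
  show "dperm_map n D (A \<otimes>\<^bsub>dperm_group n D\<^esub> B) p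
    = compose (grid n D) (dperm_map n D A) (dperm_map n D B) p"
  proof (cases "p \<in> grid n D")
    case True
    then have "p i \<le> n" if "i \<in> {1..D}" for i
      using that by (auto simp: grid_def PiE_iff)
    moreover have "(\<lambda>i\<in>{1..D}. B i (p i)) \<in> grid n D"
      using dperm_map_in_grid [OF B True] True by (simp add: dperm_map_def)
    ultimately show ?thesis
      using True dperm_mult_apply [OF A B]
      by (auto simp: dperm_map_def compose_def restrict_def)
  qed (simp add: dperm_map_def compose_def)
qed

lemma dperm_group_action: "group_action (dperm_group n D) (grid n D) (dperm_map n D)"
proof -
  have "dperm_map n D \<in> hom (dperm_group n D) (BijGroup (grid n D))"
    by (rule homI) (simp_all add: BijGroup_def dperm_map_Bij dperm_map_mult)
  then show ?thesis
    by (simp add: group_action_def group_hom_def group_hom_axioms_def group_dperm group_BijGroup)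
qed

section \<open>Pointwise fixing subgroups and their cosets\<close>

lemma subgroup_fixing:
  assumes \<Lambda>: "\<forall>i\<in>{1..D}. \<Lambda> i \<subseteq> {0..n}"
  shows "subgroup (fixing_subgroup n D \<Lambda>) (dperm_group n D)"
proof -
  interpret group "dperm_group n D"
    by (rule group_dperm)
  have le: "j \<le> n" if "i \<in> {1..D}" "j \<in> \<Lambda> i" for i j
    using \<Lambda> that by force
  show ?thesis
  proof (rule subgroupI)
    show "fixing_subgroup n D \<Lambda> \<subseteq> carrier (dperm_group n D)"
      by (auto simp: fixing_subgroup_def)
    have "\<one>\<^bsub>dperm_group n D\<^esub> \<in> fixing_subgroup n D \<Lambda>"
      using le by (auto simp: fixing_subgroup_def dperm_one_apply)
    then show "fixing_subgroup n D \<Lambda> \<noteq> {}"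
      by blast
  next
    fix A
    assume "A \<in> fixing_subgroup n D \<Lambda>"
    then have A: "A \<in> carrier (dperm_group n D)"
      and fix_A: "\<And>i j. i \<in> {1..D} \<Longrightarrow> j \<in> \<Lambda> i \<Longrightarrow> A i j = j"
      by (auto simp: fixing_subgroup_def)
    have "(inv\<^bsub>dperm_group n D\<^esub> A) i j = j" if ij: "i \<in> {1..D}" "j \<in> \<Lambda> i" for i j
    proof -
      have "(inv\<^bsub>dperm_group n D\<^esub> A) i j = (inv\<^bsub>dperm_group n D\<^esub> A) i (A i j)"
        using fix_A ij by simp
      also have "\<dots> = (inv\<^bsub>dperm_group n D\<^esub> A \<otimes>\<^bsub>dperm_group n D\<^esub> A) i j"
        using dperm_mult_apply [OF inv_closed [OF A] A ij(1) le [OF ij]] by simp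
      also have "\<dots> = j"
        using A dperm_one_apply [OF ij(1) le [OF ij]] by simp
      finally show ?thesis .
    qed
    then show "inv\<^bsub>dperm_group n D\<^esub> A \<in> fixing_subgroup n D \<Lambda>"
      using A by (simp add: fixing_subgroup_def)
  next
    fix A B
    assume "A \<in> fixing_subgroup n D \<Lambda>" "B \<in> fixing_subgroup n D \<Lambda>"
    then show "A \<otimes>\<^bsub>dperm_group n D\<^esub> B \<in> fixing_subgroup n D \<Lambda>"
      using le by (simp add: fixing_subgroup_def dperm_mult_apply)
  qed
qed

text \<open>
  A tuple \<open>B\<close> factors as \<open>A \<cdot> C\<close> only with \<open>C = A\<^sup>-\<^sup>1 B\<close>. Cancelling the injective \<open>A i\<close> in
  \<open>A i (C i j) = B i j\<close> shows that \<open>C\<close> fixes \<open>j\<close> exactly if \<open>A i j = B i j\<close>.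
\<close>

lemma l_coset_fixing:
  assumes \<Lambda>: "\<forall>i\<in>{1..D}. \<Lambda> i \<subseteq> {0..n}" and A: "A \<in> carrier (dperm_group n D)"
  shows "A <#\<^bsub>dperm_group n D\<^esub> fixing_subgroup n D \<Lambda>
    = {B \<in> carrier (dperm_group n D). \<forall>i\<in>{1..D}. \<forall>j\<in>\<Lambda> i. B i j = A i j}"
    (is "?coset = ?agree")
proof -
  interpret group "dperm_group n D"
    by (rule group_dperm)
  have le: "j \<le> n" if "i \<in> {1..D}" "j \<in> \<Lambda> i" for i j
    using \<Lambda> that by force
  show ?thesis
  proof
    show "?coset \<subseteq> ?agree"
      using A le by (auto simp: l_coset_def fixing_subgroup_def dperm_mult_apply)
  next
    show "?agree \<subseteq> ?coset"
    proof
      fix B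
      assume "B \<in> ?agree"
      then have B: "B \<in> carrier (dperm_group n D)"
        and agree: "\<And>i j. i \<in> {1..D} \<Longrightarrow> j \<in> \<Lambda> i \<Longrightarrow> B i j = A i j"
        by auto
      define C where "C = inv\<^bsub>dperm_group n D\<^esub> A \<otimes>\<^bsub>dperm_group n D\<^esub> B"
      have C: "C \<in> carrier (dperm_group n D)"
        using A B by (simp add: C_def)
      have AC: "A \<otimes>\<^bsub>dperm_group n D\<^esub> C = B"
        using A B by (simp add: C_def flip: m_assoc)
      have "C i j = j" if ij: "i \<in> {1..D}" "j \<in> \<Lambda> i" for i j
      proof -
        have "A i (C i j) = A i j"
          using dperm_mult_apply [OF A C ij(1) le [OF ij]] agree [OF ij] by (simp add: AC)
        then show ?thesis
          using dperm_component_eq_iff [OF A ij(1) dperm_component_le [OF C ij(1)]] le [OF ij]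
          by blast
      qed
      then have "C \<in> fixing_subgroup n D \<Lambda>"
        using C by (simp add: fixing_subgroup_def)
      then show "B \<in> ?coset"
        using AC by (auto simp: l_coset_def)
    qed
  qed
qed

section \<open>Translates of the principal lattice\<close>

theorem theorem4p4:
  fixes n D :: nat and \<Lambda> :: "nat \<Rightarrow> nat set"
  assumes "D \<ge> 1" and "n \<ge> 1"
    and "\<forall>i\<in>{1..D}. \<Lambda> i \<subseteq> {0..n}"
  shows "\<forall>A \<in> carrier (dperm_group n D).
           dperm_map n D A ` W_set n D \<Lambda>
             = (\<Inter>B \<in> A <#\<^bsub>dperm_group n D\<^esub> fixing_subgroup n D \<Lambda>.
                  dperm_map n D B ` principal_lattice n D)
         \<and> A <#\<^bsub>dperm_group n D\<^esub> fixing_subgroup n D \<Lambda>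
             = {B \<in> carrier (dperm_group n D). \<forall>i\<in>{1..D}. \<forall>j\<in>\<Lambda> i. B i j = A i j}"
proof (intro ballI conjI)
  fix A
  assume A: "A \<in> carrier (dperm_group n D)"
  interpret group_action "dperm_group n D" "grid n D" "dperm_map n D"
    by (rule dperm_group_action)
  show "dperm_map n D A ` W_set n D \<Lambda>
      = (\<Inter>B \<in> A <#\<^bsub>dperm_group n D\<^esub> fixing_subgroup n D \<Lambda>.
           dperm_map n D B ` principal_lattice n D)"
    unfolding W_set_def fixing_orbit_def
    by (rule image_orbit_core [OF subgroup_fixing [OF assms(3)] A principal_lattice_subset_grid])
  show "A <#\<^bsub>dperm_group n D\<^esub> fixing_subgroup n D \<Lambda>
      = {B \<in> carrier (dperm_group n D). \<forall>i\<in>{1..D}. \<forall>j\<in>\<Lambda> i. B i j = A i j}"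
    by (rule l_coset_fixing [OF assms(3) A])
qed

end
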